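(* Let $a_1,\dots,a_n \in \mathbb{R}^d$ satisfy $\frac1n \sum_{i=1}^n a_i a_i^T = I$, let $y_1,\dots,y_n \ge 0$, and let $$F(u) = \frac{1}{2n}\sum_{i=1}^n \big(|a_i^T u| - y_i\big)^2, \qquad u \in \mathbb{R}^d.$$ Then at every point $u \in \mathbb{R}^d$ with $a_i^T u \ne 0$ for all $i = 1,\dots,n$, the function $F$ is twice differentiable with $\nabla^2 F(u) = I$, and the Newton update $u - (\nabla^2 F(u))^{-1} \nabla F(u)$ coincides with the Bures-Wasserstein gradient descent update with step size $\eta = 1$, that is, $$u - (\nabla^2 F(u))^{-1}\nabla F(u) = \frac1n \sum_{i=1}^n \frac{y_i\, a_i a_i^T u}{|a_i^T u|}.$$
   Context: The Bures-Wasserstein gradient descent (BWGD) update with step size $\eta \in [0,1]$ maps $u$ to $(1-\eta)u + \frac{\eta}{n}\sum_{i=1}^n \frac{y_i a_i a_i^T u}{|a_i^T u|}$. *)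

theory Defs
  imports "HOL-Analysis.Analysis"
begin

(* The gradient is the vector representing the Frechet derivative, which is unique when it
   exists. At points where f is not differentiable the value is unspecified. *)
definition gradient :: "('a::real_inner \<Rightarrow> real) \<Rightarrow> 'a \<Rightarrow> 'a" where
  "gradient f x = (THE D. GDERIV f x :> D)"

definition hessian :: "(real^'d \<Rightarrow> real) \<Rightarrow> real^'d \<Rightarrow> real^'d^'d" where
  "hessian f x = jacobian (gradient f) (at x)"

(* Differentiability of f on a neighbourhood of x is required so that the gradient whose
   derivative is taken at x is meaningful near x. *)
definition twice_differentiable_at :: "(real^'d \<Rightarrow> real) \<Rightarrow> real^'d \<Rightarrow> bool" where
  "twice_differentiable_at f x \<longleftrightarrow>
     (\<forall>\<^sub>F z in nhds x. f differentiable (at z)) \<and> gradient f differentiable (at x)"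

definition newton_update :: "(real^'d \<Rightarrow> real) \<Rightarrow> real^'d \<Rightarrow> real^'d" where
  "newton_update f u = u - matrix_inv (hessian f u) *v gradient f u"

definition outer_product :: "real^'d \<Rightarrow> real^'d \<Rightarrow> real^'d^'d" where
  "outer_product v w = (\<chi> i j. v $ i * w $ j)"

definition objective :: "nat \<Rightarrow> (nat \<Rightarrow> real^'d) \<Rightarrow> (nat \<Rightarrow> real) \<Rightarrow> real^'d \<Rightarrow> real" where
  "objective n a y u = 1 / (2 * real n) * (\<Sum>i=1..n. (\<bar>a i \<bullet> u\<bar> - y i)\<^sup>2)"

definition bwgd_update ::
  "real \<Rightarrow> nat \<Rightarrow> (nat \<Rightarrow> real^'d) \<Rightarrow> (nat \<Rightarrow> real) \<Rightarrow> real^'d \<Rightarrow> real^'d" where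
  "bwgd_update \<eta> n a y u =
     (1 - \<eta>) *\<^sub>R u +
     (\<eta> / real n) *\<^sub>R (\<Sum>i=1..n. (y i / \<bar>a i \<bullet> u\<bar>) *\<^sub>R (outer_product (a i) (a i) *v u))"

end

theory Submission
  imports Defs
begin

text \<open>Near a point where no inner product with the measurement vectors vanishes, the signs of
  these inner products are constant. Since the vectors form a tight frame, the objective has
  gradient \<open>z - c\<close> there with a constant vector \<open>c\<close>, so its Hessian is the identity and the
  Newton update is \<open>c\<close>.\<close>

text \<open>Frechet derivatives are unique and a vector is determined by its inner products with all
  vectors, so the \<open>THE\<close> in \<open>gradient\<close> has exactly one candidate.\<close>

lemma gradient_eqI:
  assumes "GDERIV f x :> D"
  shows "gradient f x = D"
  unfolding gradient_def
proof (rule the_equality)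
  fix D' assume "GDERIV f x :> D'"
  then have "(\<lambda>h. h \<bullet> D') = (\<lambda>h. h \<bullet> D)"
    using assms has_derivative_unique unfolding gderiv_def by blast
  then show "D' = D"
    by (metis vector_eq_ldot)
qed (fact assms)

lemma hessian_eqI:
  assumes "(gradient f has_derivative (\<lambda>h. A *v h)) (at x)"
  shows "hessian f x = A"
  using frechet_derivative_at[OF assms] by (metis hessian_def jacobian_def matrix_of_matrix_vector_mul)

text \<open>\<open>matrix_inv\<close> chooses a two-sided inverse by \<open>SOME\<close>; the
  identity matrix has only itself to choose.\<close>

lemma matrix_inv_mat_1: "matrix_inv (mat 1 :: real^'d^'d) = mat 1"
  unfolding matrix_inv_def by (rule some_equality) auto

lemma outer_product_mult_vector: "outer_product v w *v x = (w \<bullet> x) *\<^sub>R v"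
  by (simp add: outer_product_def matrix_vector_mult_def vec_eq_iff inner_vec_def
      sum_distrib_left mult_ac)

lemma sum_matrix_vector_mult:
  fixes A :: "'i \<Rightarrow> real^'n^'m"
  shows "(\<Sum>i\<in>I. A i) *v x = (\<Sum>i\<in>I. A i *v x)"
  by (induction I rule: infinite_finite_induct) (simp_all add: matrix_vector_mult_add_rdistrib)

text \<open>Apply both sides of the frame identity to \<open>z\<close>: each outer product sends
  \<open>z\<close> to \<open>(a i \<bullet> z) *\<^sub>R a i\<close>.\<close>

lemma tight_frame_reconstruction:
  assumes "(1 / real n) *\<^sub>R (\<Sum>i=1..n. outer_product (a i) (a i)) = mat 1"
  shows "(1 / real n) *\<^sub>R (\<Sum>i=1..n. (a i \<bullet> z) *\<^sub>R a i) = z"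
proof -
  have "z = ((1 / real n) *\<^sub>R (\<Sum>i=1..n. outer_product (a i) (a i))) *v z"
    by (simp only: assms matrix_vector_mul_lid)
  also have "\<dots> = (1 / real n) *\<^sub>R ((\<Sum>i=1..n. outer_product (a i) (a i)) *v z)"
    by (rule scaleR_matrix_vector_assoc[symmetric])
  also have "\<dots> = (1 / real n) *\<^sub>R (\<Sum>i=1..n. (a i \<bullet> z) *\<^sub>R a i)"
    by (simp add: sum_matrix_vector_mult outer_product_mult_vector)
  finally show ?thesis by simp
qed

lemma GDERIV_objective:
  assumes "\<And>i. i \<in> {1..n} \<Longrightarrow> a i \<bullet> z \<noteq> 0"
  shows "GDERIV (objective n a y) z :>
    (1 / real n) *\<^sub>R (\<Sum>i=1..n. (a i \<bullet> z - y i * sgn (a i \<bullet> z)) *\<^sub>R a i)"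
proof -
  have "((\<lambda>u. (\<bar>a i \<bullet> u\<bar> - y i)\<^sup>2) has_derivative
      (\<lambda>h. 2 * ((a i \<bullet> z - y i * sgn (a i \<bullet> z)) * (h \<bullet> a i)))) (at z)"
    if "i \<in> {1..n}" for i
  proof -
    have "((\<lambda>u. \<bar>a i \<bullet> u\<bar>) has_derivative (\<lambda>h. (h \<bullet> a i) * sgn (a i \<bullet> z))) (at z)"
      using has_derivative_compose[OF has_derivative_inner_right[OF has_derivative_ident]
          has_derivative_norm[OF assms[OF that]]]
      by (simp add: inner_commute sgn_real_def)
    from has_derivative_power[OF has_derivative_diff[OF this has_derivative_const], of "y i" 2]
    show ?thesis
      \<comment> \<open>With t = \<open>a i \<bullet> z\<close>, the chain rule produces the factor
        (|t| - y) sgn t, which equals t - y sgn t because |t| sgn t = t.\<close>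
      by (rule has_derivative_eq_rhs)
        (simp add: fun_eq_iff algebra_simps abs_mult_sgn flip: sgn_mult_abs)
  qed
  then have "(objective n a y has_derivative (\<lambda>h. 1 / (2 * real n) *
      (\<Sum>i=1..n. 2 * ((a i \<bullet> z - y i * sgn (a i \<bullet> z)) * (h \<bullet> a i))))) (at z)"
    unfolding objective_def[abs_def] by (intro has_derivative_mult_right has_derivative_sum)
  then show ?thesis
    unfolding gderiv_def
    by (rule has_derivative_eq_rhs) (simp add: inner_sum_right flip: sum_distrib_left)
qed

theorem mainTheorem2:
  fixes n :: nat and a :: "nat \<Rightarrow> real^'d" and y :: "nat \<Rightarrow> real" and u :: "real^'d"
  assumes "n \<ge> 1"
    and "(1 / real n) *\<^sub>R (\<Sum>i=1..n. outer_product (a i) (a i)) = mat 1"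
    and "\<forall>i\<in>{1..n}. y i \<ge> 0"
    and "\<forall>i\<in>{1..n}. a i \<bullet> u \<noteq> 0"
  shows "twice_differentiable_at (objective n a y) u
    \<and> hessian (objective n a y) u = mat 1
    \<and> newton_update (objective n a y) u = bwgd_update 1 n a y u
    \<and> newton_update (objective n a y) u =
        (1 / real n) *\<^sub>R
          (\<Sum>i=1..n. (y i / \<bar>a i \<bullet> u\<bar>) *\<^sub>R (outer_product (a i) (a i) *v u))"
proof -
  define F where "F = objective n a y"
  define c where "c = (1 / real n) *\<^sub>R (\<Sum>i=1..n. (y i * sgn (a i \<bullet> u)) *\<^sub>R a i)"
  have "\<forall>\<^sub>F z in nhds u. sgn (a i \<bullet> z) = sgn (a i \<bullet> u)" if "i \<in> {1..n}" for i
  proof -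
    \<comment> \<open>Sign agreement is expressed by positivity of a product that is continuous in
      \<open>z\<close>; at \<open>u\<close> it is a nonzero square.\<close>
    have "((\<lambda>z. a i \<bullet> z * (a i \<bullet> u)) \<longlongrightarrow> a i \<bullet> u * (a i \<bullet> u)) (nhds u)"
      by (intro tendsto_intros filterlim_ident)
    moreover have "a i \<bullet> u * (a i \<bullet> u) > 0"
      using assms(4) that by (metis not_real_square_gt_zero)
    ultimately have "\<forall>\<^sub>F z in nhds u. a i \<bullet> z * (a i \<bullet> u) > 0"
      by (rule order_tendstoD(1))
    then show ?thesis
      by eventually_elim (auto simp: zero_less_mult_iff)
  qed
  then have "\<forall>\<^sub>F z in nhds u. \<forall>i\<in>{1..n}. sgn (a i \<bullet> z) = sgn (a i \<bullet> u)"
    by (simp add: eventually_ball_finite_distrib)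
  \<comment> \<open>The formula is needed on a whole neighbourhood, since the gradient is to be
    differentiated at \<open>u\<close>. There \<open>c\<close> can be built from the signs at
    \<open>u\<close>, and the frame identity turns the remaining sum into \<open>z\<close>.\<close>
  then have gderiv: "\<forall>\<^sub>F z in nhds u. GDERIV F z :> z - c"
  proof eventually_elim
    case (elim z)
    then have "GDERIV F z :>
        (1 / real n) *\<^sub>R (\<Sum>i=1..n. (a i \<bullet> z - y i * sgn (a i \<bullet> z)) *\<^sub>R a i)"
      unfolding F_def using assms(4) by (intro GDERIV_objective) (metis sgn_0_0)
    also have "(1 / real n) *\<^sub>R (\<Sum>i=1..n. (a i \<bullet> z - y i * sgn (a i \<bullet> z)) *\<^sub>R a i) =
        (1 / real n) *\<^sub>R (\<Sum>i=1..n. (a i \<bullet> z) *\<^sub>R a i) - c"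
      using elim by (simp add: c_def scaleR_left_diff_distrib sum_subtractf scaleR_right_diff_distrib)
    finally show ?case
      by (simp only: tight_frame_reconstruction[OF assms(2)])
  qed
  then have grad: "\<forall>\<^sub>F z in nhds u. gradient F z = z - c"
    by eventually_elim (rule gradient_eqI)
  have "((\<lambda>z. z - c) has_derivative (\<lambda>h. mat 1 *v h)) (at u)"
    by (auto intro!: derivative_eq_intros)
  then have deriv: "(gradient F has_derivative (\<lambda>h. mat 1 *v h)) (at u)"
    \<comment> \<open>The transfer needs agreement on a punctured neighbourhood and at
      \<open>u\<close> itself; \<open>grad\<close> supplies both.\<close>
    by (rule has_derivative_transform_eventually)
      (use grad eventually_nhds_x_imp_x[OF grad] in \<open>auto simp: eventually_at_filter elim: eventually_mono\<close>)
  have "\<forall>\<^sub>F z in nhds u. F differentiable (at z)"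
    using gderiv by eventually_elim (auto simp: gderiv_def differentiable_def)
  with deriv have twice: "twice_differentiable_at F u"
    by (auto simp: twice_differentiable_at_def differentiable_def)
  have hess: "hessian F u = mat 1"
    using deriv by (rule hessian_eqI)
  have newton: "newton_update F u = c"
    using eventually_nhds_x_imp_x[OF grad] by (simp add: newton_update_def hess matrix_inv_mat_1)
  \<comment> \<open>The two forms agree because sgn t = t / |t|, with the numerator t absorbed into
    the outer product applied to \<open>u\<close>.\<close>
  have c: "c = (1 / real n) *\<^sub>R
      (\<Sum>i=1..n. (y i / \<bar>a i \<bullet> u\<bar>) *\<^sub>R (outer_product (a i) (a i) *v u))"
    unfolding c_def by (simp add: outer_product_mult_vector sgn_div_norm divide_inverse mult_ac)
  \<comment> \<open>At step size 1 the term \<open>(1 - \<eta>) *\<^sub>R u\<close> of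
    \<open>bwgd_update\<close> vanishes and only the average, which is \<open>c\<close>,
    remains.\<close>
  show ?thesis
    using twice hess newton c by (simp add: F_def bwgd_update_def)
qed

end
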